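(* Fix a slot $t$ and consider the convex problem $$\min_{\tilde{\bm\mu}_c(t)}\ W\sum_{i\in\mathcal N\setminus\mathcal N_t}\Big[S_i(t)-Q_i(t)-\tfrac1pZ_i(t)\Big]\mu_i(t)\log_2\!\Big(1+\frac{\delta_i(t)\mu_0(t)}{\mu_i(t)}\Big)$$ $$\text{s.t.}\quad \mu_0(t)+\sum_{i\in\mathcal N\setminus\mathcal N_t}\mu_i(t)\le 1,\qquad \mu_i(t)>0\ \ \forall i\in\tilde{\mathcal N}\setminus\mathcal N_t.$$ Denote by $\lambda^*(t)$ the optimal Lagrange multiplier of the KKT conditions of this problem at slot $t$. The optimal solutions satisfy $$\mu_0^*(t)=\frac{1}{1+\sum_{j\in\mathcal N\setminus\mathcal N_t}\delta_j(t)\Phi_j(\lambda^*(t))},$$ $$\mu_i^*(t)=\frac{\delta_i(t)\Phi_i(\lambda^*(t))}{1+\sum_{j\in\mathcal N\setminus\mathcal N_t}\delta_j(t)\Phi_j(\lambda^*(t))},\qquad i\in\mathcal N\setminus\mathcal N_t,$$ where $$\Phi_i(\lambda^*(t))=-\left[1+\frac{1}{W_0\!\left(-\exp\!\left(\dfrac{\ln 2\;\lambda^*(t)}{S_i(t)-Q_i(t)-\frac1pZ_i(t)}-1\right)\right)}\right]^{-1}$$ and $W_0(x)$ is the principal branch of the Lambert W function, defined as the solution of $W_0(x)\exp(W_0(x))=x$.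
   Context: $\mathcal N=\{1,\dots,N\}$ indexes wireless devices, $0$ indexes the access point, and $\tilde{\mathcal N}=\{0\}\cup\mathcal N$. In the fixed slot $t$, the following are given constants: the queue backlogs $Q_i(t),S_i(t),Z_i(t)\ge0$ ($i\in\mathcal N$), the price $p\ge1$, the bandwidth $W>0$, and $\delta_i(t)=\xi_iP_0h_i^2(t)/N_0$, where $\xi_i\in(0,1)$ is the energy harvesting efficiency, $P_0$ the transmit power of the access point, $h_i(t)$ the channel gain and $N_0$ the noise power. $\mathcal N_t=\{i\in\mathcal N: S_i(t)-Q_i(t)-\tfrac1pZ_i(t)\ge0\}$. The optimization variables are the time portions $\tilde{\bm\mu}_c(t)=\{\mu_i(t): i\in\tilde{\mathcal N}\setminus\mathcal N_t\}$, with $\mu_0(t)$ the portion for wireless power transfer and $\mu_i(t)$ the portion for device $i$ to offload data. The Lagrange multiplier $\lambda(t)\ge0$ is the one associated with the constraint $\sum_{i\in\tilde{\mathcal N}\setminus\mathcal N_t}\mu_i(t)\le1$. The symbol $W$ (bandwidth) is distinct from the Lambert function $W_0$.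
   Formalization: Φ_i is evaluated at λ*/W instead of λ*, since the printed formula omits the bandwidth factor and fails for W ≠ 1; N∖N_t is assumed nonempty (otherwise every μ_0 in (0,1] is optimal), and P_0, N_0 and the channel gains h_i are assumed positive. *)

theory Defs
  imports Complex_Main
begin

text \<open>
  The variable vector is a function \<^term>\<open>\<mu> :: nat \<Rightarrow> real\<close> of which only the entries at
  \<^term>\<open>insert 0 D\<close> matter: index 0 is the access point (wireless power transfer), and
  \<^term>\<open>D\<close> is the set of devices that offload data.
\<close>

text \<open>
  The bound \<^term>\<open>- 1 \<le> w\<close> selects the principal branch; the description is meaningful only for
  \<^term>\<open>x \<ge> - exp (- 1)\<close>.
\<close>

definition lambert_W0 :: "real \<Rightarrow> real" where
  "lambert_W0 x = (THE w. - 1 \<le> w \<and> w * exp w = x)"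

definition queue_weight ::
    "real \<Rightarrow> (nat \<Rightarrow> real) \<Rightarrow> (nat \<Rightarrow> real) \<Rightarrow> (nat \<Rightarrow> real) \<Rightarrow> nat \<Rightarrow> real" where
  "queue_weight p Q S Z i = S i - Q i - 1 / p * Z i"

definition snr_coeff ::
    "(nat \<Rightarrow> real) \<Rightarrow> real \<Rightarrow> (nat \<Rightarrow> real) \<Rightarrow> real \<Rightarrow> nat \<Rightarrow> real" where
  "snr_coeff \<xi> P0 h N0 i = \<xi> i * P0 * (h i)\<^sup>2 / N0"

definition nonneg_devices :: "nat \<Rightarrow> (nat \<Rightarrow> real) \<Rightarrow> nat set" where
  "nonneg_devices N c = {i \<in> {1..N}. c i \<ge> 0}"

definition objective ::
    "real \<Rightarrow> (nat \<Rightarrow> real) \<Rightarrow> (nat \<Rightarrow> real) \<Rightarrow> nat set \<Rightarrow> (nat \<Rightarrow> real) \<Rightarrow> real" where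
  "objective W c \<delta> D \<mu> = W * (\<Sum>i\<in>D. c i * \<mu> i * log 2 (1 + \<delta> i * \<mu> 0 / \<mu> i))"

definition feasible :: "nat set \<Rightarrow> (nat \<Rightarrow> real) \<Rightarrow> bool" where
  "feasible D \<mu> \<longleftrightarrow> \<mu> 0 + (\<Sum>i\<in>D. \<mu> i) \<le> 1 \<and> (\<forall>i\<in>insert 0 D. \<mu> i > 0)"

definition optimal_solution ::
    "real \<Rightarrow> (nat \<Rightarrow> real) \<Rightarrow> (nat \<Rightarrow> real) \<Rightarrow> nat set \<Rightarrow> (nat \<Rightarrow> real) \<Rightarrow> bool" where
  "optimal_solution W c \<delta> D \<mu> \<longleftrightarrow> is_arg_min (objective W c \<delta> D) (feasible D) \<mu>"

definition lagrangian ::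
    "real \<Rightarrow> (nat \<Rightarrow> real) \<Rightarrow> (nat \<Rightarrow> real) \<Rightarrow> nat set \<Rightarrow> real \<Rightarrow> (nat \<Rightarrow> real) \<Rightarrow> real" where
  "lagrangian W c \<delta> D lam \<mu> = objective W c \<delta> D \<mu> + lam * (\<mu> 0 + (\<Sum>i\<in>D. \<mu> i) - 1)"

text \<open>
  Primal feasibility, dual feasibility, complementary slackness and stationarity (all partial
  derivatives of the Lagrangian vanish).  The positivity constraints are strict, hence never
  active, so they carry no multiplier.
\<close>

definition kkt_point ::
    "real \<Rightarrow> (nat \<Rightarrow> real) \<Rightarrow> (nat \<Rightarrow> real) \<Rightarrow> nat set \<Rightarrow> (nat \<Rightarrow> real) \<Rightarrow> real \<Rightarrow> bool" where
  "kkt_point W c \<delta> D \<mu> lam \<longleftrightarrow>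
     feasible D \<mu> \<and> lam \<ge> 0 \<and> lam * (\<mu> 0 + (\<Sum>i\<in>D. \<mu> i) - 1) = 0 \<and>
     (\<forall>k\<in>insert 0 D.
        ((\<lambda>x. lagrangian W c \<delta> D lam (\<mu>(k := x))) has_real_derivative 0) (at (\<mu> k)))"

definition optimal_multiplier ::
    "real \<Rightarrow> (nat \<Rightarrow> real) \<Rightarrow> (nat \<Rightarrow> real) \<Rightarrow> nat set \<Rightarrow> real \<Rightarrow> bool" where
  "optimal_multiplier W c \<delta> D lam \<longleftrightarrow> (\<exists>\<mu>. kkt_point W c \<delta> D \<mu> lam)"

text \<open>
  The argument of \<^term>\<open>\<Phi>\<close> is the multiplier for the objective normalised to unit bandwidth.  The
  stationarity condition in \<^term>\<open>\<mu> i\<close>, where \<^term>\<open>y = 1 + \<delta> i * \<mu> 0 / \<mu> i\<close>, reads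
  \<^term>\<open>ln y + 1 / y = 1 - ln 2 * lam / (W * c i)\<close>, so a multiplier \<^term>\<open>lam\<close> of the problem with
  bandwidth \<^term>\<open>W\<close> enters as \<^term>\<open>lam / W\<close>.
\<close>

definition \<Phi> :: "(nat \<Rightarrow> real) \<Rightarrow> nat \<Rightarrow> real \<Rightarrow> real" where
  "\<Phi> c i lam = - inverse (1 + 1 / lambert_W0 (- exp (ln 2 * lam / c i - 1)))"

end

theory Submission imports Defs begin

text \<open>
  Write \<open>y\<^sub>i = 1 + \<delta>\<^sub>i \<nu>\<^sub>0 / \<nu>\<^sub>i\<close> for a KKT point \<open>\<nu>\<close>.  Stationarity in \<open>\<nu>\<^sub>i\<close> says
  \<open>w exp w = - exp (ln 2 * lam / (W c\<^sub>i) - 1)\<close> for \<open>w = - 1 / y\<^sub>i \<in> {-1<..<0}\<close>, so the principal Lambert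
  branch recovers \<open>y\<^sub>i\<close> from the multiplier and \<open>\<delta>\<^sub>i \<Phi>\<^sub>i = \<nu>\<^sub>i / \<nu>\<^sub>0\<close>; as the multiplier is positive, the
  budget constraint is tight and the formulas hold for \<open>\<nu>\<close>.

  It remains to see that the optimal solution \<open>\<mu>\<close> coincides with \<open>\<nu>\<close>.  The objective is positively homogeneous of
  degree one, so its tangent plane at \<open>\<nu>\<close> is \<open>\<mu> \<mapsto> - lam (\<mu>\<^sub>0 + \<Sum>\<^sub>i \<mu>\<^sub>i)\<close>.  The objective
  lies above this plane, strictly unless \<open>\<mu>\<^sub>i / \<mu>\<^sub>0 = \<nu>\<^sub>i / \<nu>\<^sub>0\<close> for all \<open>i\<close>.
\<close>

section \<open>The principal Lambert branch and tangents of the logarithm\<close>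

lemma lambert_W0_eqI:
  assumes "- 1 \<le> w" "w * exp w = x"
  shows "lambert_W0 x = w"
proof -
  have mono: "a * exp a < b * exp b" if "- 1 \<le> a" "a < b" for a b :: real
  \<comment> \<open>The derivative \<open>(1 + z) * exp z\<close> vanishes at \<open>-1\<close>,
    which may be the left endpoint, so positivity is available only in the open interval.\<close>
  proof (rule DERIV_pos_imp_increasing_open[OF \<open>a < b\<close>])
    show "\<exists>y. ((\<lambda>w. w * exp w) has_real_derivative y) (at z) \<and> y > 0" if "a < z" "z < b" for z
    proof (intro exI conjI)
      show "((\<lambda>w. w * exp w) has_real_derivative (1 + z) * exp z) (at z)"
        by (auto intro!: derivative_eq_intros simp: algebra_simps)
      show "(1 + z) * exp z > 0"
        using that \<open>- 1 \<le> a\<close> by simp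
    qed
  qed (intro continuous_intros)
  show ?thesis
    unfolding lambert_W0_def
  proof (rule the_equality)
    fix v assume "- 1 \<le> v \<and> v * exp v = x"
    then show "v = w"
      using mono[of v w] mono[of w v] assms by (metis less_irrefl linorder_neqE_linordered_idom)
  qed (use assms in auto)
qed

lemma ln_le_tangent:
  fixes x y :: real
  assumes "0 < x" "0 < y"
  shows "ln x \<le> ln y + (x - y) / y"
  using ln_le_minus_one[of "x / y"] assms by (simp add: ln_div diff_divide_distrib)

text \<open>Equality in \<open>ln t \<le> t - 1\<close> occurs only at \<open>t = 1\<close>. This
  strictness gives both a positive multiplier and uniqueness of the optimum.\<close>

lemma ln_less_tangent:
  fixes x y :: real
  assumes "0 < x" "0 < y" "x \<noteq> y"
  shows "ln x < ln y + (x - y) / y"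
proof -
  have "ln (x / y) \<noteq> x / y - 1"
    using ln_eq_minus_one[of "x / y"] assms by auto
  then show ?thesis
    using ln_le_tangent[OF assms(1,2)] assms by (auto simp: ln_div diff_divide_distrib)
qed

section \<open>Partial derivatives of the Lagrangian, and the objective in natural
  logarithms\<close>

lemma lagrangian_deriv_device:
  assumes "finite D" "0 \<notin> D" "i \<in> D" "\<nu> i > 0" "\<nu> 0 > 0" "\<delta> i > 0"
  defines "y \<equiv> 1 + \<delta> i * \<nu> 0 / \<nu> i"
  shows "((\<lambda>x. lagrangian W c \<delta> D lam (\<nu>(i := x))) has_real_derivative
           W * c i / ln 2 * (ln y - (y - 1) / y) + lam) (at (\<nu> i))"
proof -
  have "i \<noteq> 0"
    using assms by metis
  \<comment> \<open>Splitting off the summand of \<open>i\<close> leaves terms constant in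
    \<open>x\<close>; \<open>i \<noteq> 0\<close> keeps \<open>\<nu> 0\<close> fixed under the
    update.\<close>
  have lagr: "lagrangian W c \<delta> D lam (\<nu>(i := x)) =
      W * c i / ln 2 * (x * ln (1 + \<delta> i * \<nu> 0 / x))
        + W * (\<Sum>j\<in>D-{i}. c j * \<nu> j * log 2 (1 + \<delta> j * \<nu> 0 / \<nu> j))
      + lam * (\<nu> 0 + (x + (\<Sum>j\<in>D-{i}. \<nu> j)) - 1)" for x
    using \<open>i \<noteq> 0\<close> assms(1,3)
    by (simp add: lagrangian_def objective_def sum.remove[of D i] log_def distrib_left)
  have "y > 0"
    unfolding y_def using assms(4-6) by (simp add: add_pos_pos)
  have "((\<lambda>x. x * ln (1 + \<delta> i * \<nu> 0 / x)) has_real_derivative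
      ln y + \<nu> i * (- (\<delta> i * \<nu> 0 / (\<nu> i * \<nu> i)) / y)) (at (\<nu> i))"
    using \<open>y > 0\<close> assms(4) unfolding y_def by (auto intro!: derivative_eq_intros)
  also have "\<nu> i * (- (\<delta> i * \<nu> 0 / (\<nu> i * \<nu> i)) / y) = - (y - 1) / y"
    using assms(4) by (simp add: y_def)
  finally have "((\<lambda>x. x * ln (1 + \<delta> i * \<nu> 0 / x)) has_real_derivative ln y - (y - 1) / y) (at (\<nu> i))"
    by (simp only: minus_divide_left[symmetric] add_uminus_conv_diff)
  note deriv = DERIV_cmult[OF this, of "W * c i / ln 2"]
  show ?thesis
    unfolding lagr by (rule derivative_eq_intros deriv refl | simp add: distrib_left)+
qed

lemma lagrangian_deriv_zero:
  assumes "0 \<notin> D" "\<nu> 0 > 0" "\<And>i. i \<in> D \<Longrightarrow> \<nu> i > 0" "\<And>i. i \<in> D \<Longrightarrow> \<delta> i > 0"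
  shows "((\<lambda>x. lagrangian W c \<delta> D lam (\<nu>(0 := x))) has_real_derivative
           W * (\<Sum>i\<in>D. c i / ln 2 * (\<delta> i / (1 + \<delta> i * \<nu> 0 / \<nu> i))) + lam) (at (\<nu> 0))"
proof -
  have upd: "(\<nu>(0 := x)) j = \<nu> j" if "j \<in> D" for x j
    using that assms(1) by (metis fun_upd_other)
  have lagr: "lagrangian W c \<delta> D lam (\<nu>(0 := x)) =
      W * (\<Sum>i\<in>D. c i * \<nu> i * (ln (1 + \<delta> i * x / \<nu> i) / ln 2)) + lam * (x + (\<Sum>i\<in>D. \<nu> i) - 1)" for x
    by (simp add: lagrangian_def objective_def log_def upd del: fun_upd_apply cong: sum.cong)
      (simp add: fun_upd_same)
  have deriv: "((\<lambda>x. \<Sum>i\<in>D. c i * \<nu> i * (ln (1 + \<delta> i * x / \<nu> i) / ln 2)) has_real_derivative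
      (\<Sum>i\<in>D. c i / ln 2 * (\<delta> i / (1 + \<delta> i * \<nu> 0 / \<nu> i)))) (at (\<nu> 0))"
  proof (rule DERIV_sum)
    fix i assume "i \<in> D"
    then have "\<nu> i > 0" "\<delta> i > 0" "1 + \<delta> i * \<nu> 0 / \<nu> i > 0"
      using assms by (auto simp: add_pos_pos)
    then show "((\<lambda>x. c i * \<nu> i * (ln (1 + \<delta> i * x / \<nu> i) / ln 2)) has_real_derivative
        c i / ln 2 * (\<delta> i / (1 + \<delta> i * \<nu> 0 / \<nu> i))) (at (\<nu> 0))"
      by (auto intro!: derivative_eq_intros simp: mult_ac)
  qed
  show ?thesis
    unfolding lagr by (rule derivative_eq_intros DERIV_cmult[OF deriv] refl | simp)+
qed

lemma objective_ln:
  "ln 2 * objective W c \<delta> D \<mu> = W * (\<Sum>i\<in>D. c i * \<mu> i * ln (1 + \<delta> i * \<mu> 0 / \<mu> i))"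
  by (simp add: objective_def log_def sum_distrib_left algebra_simps)

section \<open>Consequences of the KKT conditions\<close>

locale kkt_situation =
  fixes W :: real and c \<delta> \<nu> :: "nat \<Rightarrow> real" and D :: "nat set" and lam :: real
  assumes fin: "finite D" and zero_notin: "0 \<notin> D" and nonempty: "D \<noteq> {}"
    and W_pos: "W > 0" and c_neg: "\<And>i. i \<in> D \<Longrightarrow> c i < 0" and \<delta>_pos: "\<And>i. i \<in> D \<Longrightarrow> \<delta> i > 0"
    and kkt: "kkt_point W c \<delta> D \<nu> lam"
begin

definition y :: "nat \<Rightarrow> real" where
  "y i = 1 + \<delta> i * \<nu> 0 / \<nu> i"

text \<open>Scaling the objective by \<open>ln 2 / W\<close> replaces \<open>log 2\<close> by
  \<open>ln\<close> and removes the bandwidth; \<open>m\<close> is the multiplier under the same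
  scaling.\<close>

definition m :: real where
  "m = ln 2 * lam / W"

lemma \<nu>_pos: "\<nu> 0 > 0" "i \<in> D \<Longrightarrow> \<nu> i > 0"
  using kkt by (auto simp: kkt_point_def feasible_def)

lemma y_gt_1: "i \<in> D \<Longrightarrow> y i > 1"
  using \<nu>_pos \<delta>_pos by (simp add: y_def)

lemma stationary_device:
  assumes "i \<in> D"
  shows "c i * (ln (y i) - (y i - 1) / y i) = - m"
proof -
  have "((\<lambda>x. lagrangian W c \<delta> D lam (\<nu>(i := x))) has_real_derivative 0) (at (\<nu> i))"
    using kkt assms by (simp add: kkt_point_def)
  moreover have "((\<lambda>x. lagrangian W c \<delta> D lam (\<nu>(i := x))) has_real_derivative
      W * c i / ln 2 * (ln (y i) - (y i - 1) / y i) + lam) (at (\<nu> i))"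
    unfolding y_def using fin zero_notin assms \<nu>_pos \<delta>_pos by (intro lagrangian_deriv_device) auto
  ultimately have "W * c i / ln 2 * (ln (y i) - (y i - 1) / y i) + lam = 0"
    by (rule DERIV_unique[symmetric])
  then have "W / ln 2 * (c i * (ln (y i) - (y i - 1) / y i)) = W / ln 2 * - m"
    using W_pos by (simp add: m_def)
  then show ?thesis
    using W_pos by (subst (asm) mult_cancel_left) simp
qed

lemma stationary_zero: "(\<Sum>i\<in>D. c i * \<delta> i / y i) = - m"
proof -
  have "((\<lambda>x. lagrangian W c \<delta> D lam (\<nu>(0 := x))) has_real_derivative 0) (at (\<nu> 0))"
    using kkt by (simp add: kkt_point_def)
  moreover have "((\<lambda>x. lagrangian W c \<delta> D lam (\<nu>(0 := x))) has_real_derivative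
      W * (\<Sum>i\<in>D. c i / ln 2 * (\<delta> i / y i)) + lam) (at (\<nu> 0))"
    unfolding y_def using zero_notin \<nu>_pos \<delta>_pos by (intro lagrangian_deriv_zero) auto
  ultimately have "W * (\<Sum>i\<in>D. c i / ln 2 * (\<delta> i / y i)) + lam = 0"
    by (rule DERIV_unique[symmetric])
  then have "W / ln 2 * (\<Sum>i\<in>D. c i * \<delta> i / y i) = W / ln 2 * - m"
    using W_pos by (simp add: m_def sum_distrib_left algebra_simps)
  then show ?thesis
    using W_pos by (subst (asm) mult_cancel_left) simp
qed

text \<open>For any device, the tangent of \<open>ln\<close> at \<open>y i > 1\<close> lies strictly
  above \<open>ln\<close> at 1. With \<open>c i < 0\<close>, the left side of its stationarity
  equation, which equals \<open>- m\<close>, is negative.\<close>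

lemma m_pos: "m > 0"
proof -
  obtain i where i: "i \<in> D"
    using nonempty by auto
  have "ln 1 < ln (y i) + (1 - y i) / y i"
    using y_gt_1[OF i] by (intro ln_less_tangent) auto
  then have "ln (y i) - (y i - 1) / y i > 0"
    by (simp add: diff_divide_distrib)
  then have "c i * (ln (y i) - (y i - 1) / y i) < 0"
    using c_neg[OF i] by (rule mult_neg_pos[rotated])
  then show ?thesis
    using stationary_device[OF i] by simp
qed

lemma budget_tight: "\<nu> 0 + (\<Sum>i\<in>D. \<nu> i) = 1"
proof -
  have "lam \<noteq> 0"
    using m_pos by (auto simp: m_def)
  then show ?thesis
    using kkt by (simp add: kkt_point_def)
qed

lemma \<delta>_\<Phi>_eq_ratio:
  assumes i: "i \<in> D"
  shows "\<delta> i * \<Phi> c i (lam / W) = \<nu> i / \<nu> 0"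
proof -
  have y: "y i > 1" "c i < 0"
    using y_gt_1 c_neg i by auto
  have "ln (y i) + 1 / y i = 1 - m / c i"
    using stationary_device[OF i] y by (simp add: field_simps)
  \<comment> \<open>Exponentiating this form and dividing by \<open>- y i\<close> gives the Lambert
    equation for \<open>- 1 / y i\<close>.\<close>
  then have "- 1 / y i = m / c i - 1 + ln (y i)"
    by simp
  then have "exp (- 1 / y i) = exp (m / c i - 1) * y i"
    using y by (simp only: exp_add exp_ln)
  then have "lambert_W0 (- exp (m / c i - 1)) = - 1 / y i"
    using y by (intro lambert_W0_eqI) (auto simp: field_simps)
  then have "\<Phi> c i (lam / W) = - inverse (1 + 1 / (- 1 / y i))"
    by (simp add: \<Phi>_def m_def)
  also have "\<dots> = 1 / (y i - 1)"
    using y by (simp add: field_simps)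
  finally have "\<Phi> c i (lam / W) = 1 / (y i - 1)" .
  \<comment> \<open>Since \<open>y i - 1 = \<delta> i * \<nu> 0 / \<nu> i\<close>, the factor
    \<open>\<delta> i\<close> cancels.\<close>
  then show ?thesis
    using \<delta>_pos[OF i] \<nu>_pos i by (simp add: y_def)
qed

section \<open>Comparison of the objective with its tangent plane\<close>

definition tangent_gap :: "(nat \<Rightarrow> real) \<Rightarrow> nat \<Rightarrow> real" where
  "tangent_gap \<mu> i = - c i * \<mu> i *
     (ln (y i) + ((1 + \<delta> i * \<mu> 0 / \<mu> i) - y i) / y i - ln (1 + \<delta> i * \<mu> 0 / \<mu> i))"

text \<open>Multiplied by \<open>c i * \<mu> i\<close>, the tangent of \<open>ln\<close> at
  \<open>y i\<close> becomes linear in \<open>\<mu> 0\<close> and \<open>\<mu> i\<close>;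
  \<open>tangent_gap\<close> is what the summand adds to it. Stationarity turns each coefficient of
  \<open>\<mu> i\<close> into \<open>- m\<close>, and that of \<open>\<mu> 0\<close> once summed
  over \<open>D\<close>.\<close>

lemma objective_eq_tangent_plus_gap:
  assumes "\<And>i. i \<in> D \<Longrightarrow> \<mu> i > 0"
  shows "ln 2 * objective W c \<delta> D \<mu> =
    W * ((\<Sum>i\<in>D. tangent_gap \<mu> i) - m * (\<mu> 0 + (\<Sum>i\<in>D. \<mu> i)))"
proof -
  have "c i * \<mu> i * ln (1 + \<delta> i * \<mu> 0 / \<mu> i) =
      tangent_gap \<mu> i + (\<mu> 0 * (c i * \<delta> i / y i) - m * \<mu> i)" if i: "i \<in> D" for i
  proof -
    have "c i * \<mu> i * ln (1 + \<delta> i * \<mu> 0 / \<mu> i) =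
      tangent_gap \<mu> i + (\<mu> 0 * (c i * \<delta> i / y i) + c i * (ln (y i) - (y i - 1) / y i) * \<mu> i)"
      using assms[OF i] y_gt_1[OF i] by (simp add: tangent_gap_def field_simps)
    then show ?thesis
      unfolding stationary_device[OF i] by simp
  qed
  then have sum_eq: "(\<Sum>i\<in>D. c i * \<mu> i * ln (1 + \<delta> i * \<mu> 0 / \<mu> i)) =
      (\<Sum>i\<in>D. tangent_gap \<mu> i) + (\<mu> 0 * (\<Sum>i\<in>D. c i * \<delta> i / y i) - m * (\<Sum>i\<in>D. \<mu> i))"
    by (simp add: sum.distrib sum_subtractf sum_distrib_left)
  show ?thesis
    unfolding objective_ln sum_eq stationary_zero by (simp add: algebra_simps)
qed

lemma optimal_solution_eq:
  assumes "optimal_solution W c \<delta> D \<mu>"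
  shows "\<forall>i\<in>insert 0 D. \<mu> i = \<nu> i"
proof -
  have feas: "\<mu> 0 + (\<Sum>i\<in>D. \<mu> i) \<le> 1" "\<mu> 0 > 0" "\<And>i. i \<in> D \<Longrightarrow> \<mu> i > 0"
    using assms by (auto simp: optimal_solution_def is_arg_min_def feasible_def)
  have arg_pos: "1 + \<delta> i * \<mu> 0 / \<mu> i > 0" if "i \<in> D" for i
    using that feas \<delta>_pos by (auto simp: add_pos_pos)
  have gap_nonneg: "tangent_gap \<mu> i \<ge> 0" if "i \<in> D" for i
    unfolding tangent_gap_def
    using ln_le_tangent[OF arg_pos[OF that], of "y i"] feas(3)[OF that] c_neg[OF that] y_gt_1[OF that]
    by (intro mult_nonneg_nonneg) auto
  have "tangent_gap \<nu> i = 0" for i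
    by (simp add: tangent_gap_def flip: y_def)
  then have "ln 2 * objective W c \<delta> D \<nu> = W * (- m)"
    using objective_eq_tangent_plus_gap[of \<nu>] \<nu>_pos budget_tight by simp
  moreover have "ln 2 * objective W c \<delta> D \<mu> \<le> ln 2 * objective W c \<delta> D \<nu>"
    using assms kkt by (auto simp: optimal_solution_def is_arg_min_def kkt_point_def not_less)
  ultimately have "W * ((\<Sum>i\<in>D. tangent_gap \<mu> i) - m * (\<mu> 0 + (\<Sum>i\<in>D. \<mu> i))) \<le> W * (- m)"
    using objective_eq_tangent_plus_gap[of \<mu>] feas(3) by simp
  then have "(\<Sum>i\<in>D. tangent_gap \<mu> i) - m * (\<mu> 0 + (\<Sum>i\<in>D. \<mu> i)) \<le> - m"
    using W_pos by (simp only: mult_le_cancel_left_pos)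
  \<comment> \<open>Both summands are nonnegative, so both vanish: every gap is zero and the budget
    is exhausted.\<close>
  then have "(\<Sum>i\<in>D. tangent_gap \<mu> i) + m * (1 - (\<mu> 0 + (\<Sum>i\<in>D. \<mu> i))) \<le> 0"
    by (simp add: algebra_simps)
  moreover have "m * (1 - (\<mu> 0 + (\<Sum>i\<in>D. \<mu> i))) \<ge> 0"
    using m_pos feas by simp
  moreover have "(\<Sum>i\<in>D. tangent_gap \<mu> i) \<ge> 0"
    using gap_nonneg by (rule sum_nonneg)
  ultimately have "(\<Sum>i\<in>D. tangent_gap \<mu> i) = 0" and "m * (1 - (\<mu> 0 + (\<Sum>i\<in>D. \<mu> i))) = 0"
    by linarith+
  then have gap: "\<And>i. i \<in> D \<Longrightarrow> tangent_gap \<mu> i = 0" and tight: "\<mu> 0 + (\<Sum>i\<in>D. \<mu> i) = 1"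
    using sum_nonneg_eq_0_iff[OF fin gap_nonneg] m_pos by auto
  have ratio: "\<mu> i = \<mu> 0 / \<nu> 0 * \<nu> i" if i: "i \<in> D" for i
  proof -
    \<comment> \<open>Were the arguments different, the strict tangent inequality would make the gap
      positive.\<close>
    have "1 + \<delta> i * \<mu> 0 / \<mu> i = y i"
      using gap[OF i] ln_less_tangent[OF arg_pos[OF i], of "y i"] feas(3)[OF i] c_neg[OF i] y_gt_1[OF i]
      by (fastforce simp: tangent_gap_def)
    then show ?thesis
      using \<delta>_pos[OF i] \<nu>_pos(1) \<nu>_pos(2)[OF i] feas(3)[OF i] by (simp add: y_def field_simps)
  qed
  \<comment> \<open>On \<open>insert 0 D\<close> the two vectors are proportional, and both have
    total 1, so the factor is 1.\<close>
  have "\<mu> 0 + (\<Sum>i\<in>D. \<mu> i) = \<mu> 0 / \<nu> 0 * (\<nu> 0 + (\<Sum>i\<in>D. \<nu> i))"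
    using ratio \<nu>_pos(1) by (simp add: distrib_left sum_distrib_left)
  then have "\<mu> 0 / \<nu> 0 = 1"
    using tight budget_tight by simp
  then show ?thesis
    using ratio \<nu>_pos(1) by simp
qed

end

theorem lemma2:
  fixes N :: nat and Q S Z \<xi> h c \<delta> \<mu> :: "nat \<Rightarrow> real"
    and p W P0 N0 lam :: real and D :: "nat set"
  defines "c \<equiv> queue_weight p Q S Z"
    and "\<delta> \<equiv> snr_coeff \<xi> P0 h N0"
    and "D \<equiv> {1..N} - nonneg_devices N c"
  assumes "\<forall>i\<in>{1..N}. Q i \<ge> 0 \<and> S i \<ge> 0 \<and> Z i \<ge> 0"
    and "p \<ge> 1" and "W > 0"
    and "\<forall>i\<in>{1..N}. 0 < \<xi> i \<and> \<xi> i < 1"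
    and "\<forall>i\<in>{1..N}. h i > 0"
    and "P0 > 0" and "N0 > 0"
    and "D \<noteq> {}"
    and "optimal_solution W c \<delta> D \<mu>"
    and "optimal_multiplier W c \<delta> D lam"
  shows "\<mu> 0 = 1 / (1 + (\<Sum>j\<in>D. \<delta> j * \<Phi> c j (lam / W))) \<and>
         (\<forall>i\<in>D. \<mu> i = \<delta> i * \<Phi> c i (lam / W) / (1 + (\<Sum>j\<in>D. \<delta> j * \<Phi> c j (lam / W))))"
proof -
  obtain \<nu> where \<nu>: "kkt_point W c \<delta> D \<nu> lam"
    using \<open>optimal_multiplier W c \<delta> D lam\<close> by (auto simp: optimal_multiplier_def)
  have D: "finite D" "0 \<notin> D" "D \<subseteq> {1..N}" "\<And>i. i \<in> D \<Longrightarrow> c i < 0"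
    unfolding D_def by (auto simp: nonneg_devices_def)
  have "\<delta> i > 0" if "i \<in> D" for i
  proof -
    have "\<xi> i > 0" "h i > 0"
      using that D(3) assms by auto
    then show ?thesis
      unfolding \<delta>_def snr_coeff_def using \<open>P0 > 0\<close> \<open>N0 > 0\<close> by simp
  qed
  then interpret kkt_situation W c \<delta> \<nu> D lam
    using D \<nu> \<open>W > 0\<close> \<open>D \<noteq> {}\<close> by unfold_locales auto
  \<comment> \<open>The ratios \<open>\<nu> j / \<nu> 0\<close> determine \<open>\<nu>\<close>
    through the tight budget: the common denominator of the formulas is
    \<open>1 / \<nu> 0\<close>.\<close>
  have "1 + (\<Sum>j\<in>D. \<delta> j * \<Phi> c j (lam / W)) = 1 + (\<Sum>j\<in>D. \<nu> j) / \<nu> 0"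
    by (simp add: \<delta>_\<Phi>_eq_ratio sum_divide_distrib)
  also have "\<dots> = (\<nu> 0 + (\<Sum>j\<in>D. \<nu> j)) / \<nu> 0"
    using \<nu>_pos(1) by (simp add: add_divide_distrib)
  also have "\<dots> = 1 / \<nu> 0"
    by (simp only: budget_tight)
  finally have "1 + (\<Sum>j\<in>D. \<delta> j * \<Phi> c j (lam / W)) = 1 / \<nu> 0" .
  then show ?thesis
    using optimal_solution_eq[OF \<open>optimal_solution W c \<delta> D \<mu>\<close>] \<nu>_pos(1) by (simp add: \<delta>_\<Phi>_eq_ratio)
qed

end
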